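(* Let $p,q$ be two distinct prime numbers, and let $k$ be the positive integer such that $p^{k-1}\,\|\,(q-1)$ (i.e. $p^{k-1}\mid q-1$ and $p^{k}\nmid q-1$). Let $a$ be a positive integer. Then $p$ divides $\sigma(q^{2a})$ if and only if $2a+1\equiv 0\pmod f$, where $f$ is the smallest odd positive integer greater than $1$ such that $q^{f}\equiv 1\pmod{p^{k}}$.
   Context: $\sigma(n)$ denotes the sum of the positive divisors of $n$; thus $\sigma(q^{2a})=1+q+\dots+q^{2a}$. The notation $p^{j}\,\|\,m$ means $p^j\mid m$ and $p^{j+1}\nmid m$. *)

theory Defs
  imports "HOL-Number_Theory.Number_Theory"
begin

definition sigma :: "nat \<Rightarrow> nat" where
  "sigma n = (\<Sum>d | d dvd n. d)"

text \<open>
  Stated as a relation rather than with \<^verbatim>\<open>LEAST\<close>, because such an exponent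
  need not exist (e.g. when the order of \<^verbatim>\<open>q\<close> modulo \<^verbatim>\<open>m\<close> is even).
\<close>

definition least_odd_exponent :: "nat \<Rightarrow> nat \<Rightarrow> nat \<Rightarrow> bool" where
  "least_odd_exponent q m f \<longleftrightarrow>
     odd f \<and> f > 1 \<and> [q ^ f = 1] (mod m) \<and>
     (\<forall>g. odd g \<and> g > 1 \<and> [q ^ g = 1] (mod m) \<longrightarrow> f \<le> g)"

end

theory Submission
  imports Defs
begin

text \<open>
  With \<open>n = 2 a + 1\<close> we have \<open>(q - 1) \<sigma>(q\<^sup>2\<^sup>a) = q\<^sup>n - 1\<close>, and \<open>q - 1\<close> contains exactly
  \<open>k - 1\<close> factors \<open>p\<close>, so \<open>p\<close> divides \<open>\<sigma>(q\<^sup>2\<^sup>a)\<close> iff \<open>q\<^sup>n \<equiv> 1\<close> modulo \<open>p\<^sup>k\<close>, i.e. iff the order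
  of \<open>q\<close> modulo \<open>p\<^sup>k\<close> divides \<open>n\<close>. That order is not 1, and if it divides the odd number \<open>n\<close>
  it is odd, hence it is the least odd exponent.
\<close>

lemma sigma_prime_power:
  assumes "prime q"
  shows "sigma (q ^ m) = (\<Sum>i\<le>m. q ^ i)"
proof -
  have "{d. d dvd q ^ m} = (\<lambda>i. q ^ i) ` {..m}"
    using assms by (auto simp: divides_primepow_nat)
  moreover have "inj_on (\<lambda>i. q ^ i) {..m}"
    using prime_gt_1_nat[OF assms] by (auto intro!: inj_onI)
  ultimately show ?thesis
    by (simp add: sigma_def sum.reindex)
qed

lemma sigma_prime_power_mult:
  assumes "prime q"
  shows "(q - 1) * sigma (q ^ m) = q ^ Suc m - 1"
proof -
  have "q > 0"
    using assms by (rule prime_gt_0_nat)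
  \<comment> \<open>Moving the 1 to the left keeps truncated subtraction from
    \<open>q ^ Suc m\<close> out of the induction.\<close>
  have "(q - 1) * (\<Sum>i\<le>m. q ^ i) + 1 = q ^ Suc m"
  proof (induction m)
    case 0
    show ?case using \<open>q > 0\<close> by simp
  next
    case (Suc m)
    have "(q - 1) * (\<Sum>i\<le>Suc m. q ^ i) + 1 = (q - 1) * q ^ Suc m + q ^ Suc m"
      using Suc.IH by (simp add: distrib_left)
    also have "\<dots> = (q - 1 + 1) * q ^ Suc m"
      by (simp only: distrib_right mult_1)
    finally show ?case using \<open>q > 0\<close> by simp
  qed
  then show ?thesis
    using sigma_prime_power[OF assms] by (metis add_diff_cancel_right')
qed

text \<open>Write \<open>r = p ^ (k - 1) * u\<close> with \<open>u\<close> prime to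
  \<open>p\<close>; cancelling \<open>p ^ (k - 1)\<close> leaves \<open>p dvd u * s\<close>.\<close>

lemma prime_dvd_iff_power_dvd_mult:
  fixes p :: nat
  assumes "prime p" and "k > 0" and "p ^ (k - 1) dvd r" and "\<not> p ^ k dvd r"
  shows "p dvd s \<longleftrightarrow> p ^ k dvd r * s"
proof -
  obtain u where u: "r = p ^ (k - 1) * u"
    using assms(3) by blast
  have pk: "p ^ k = p ^ (k - 1) * p"
    using assms(2) by (simp add: power_eq_if)
  have "p ^ (k - 1) \<noteq> 0"
    using assms(1) by auto
  then have "\<not> p dvd u" and "p ^ k dvd r * s \<longleftrightarrow> p dvd u * s"
    using assms(4) by (auto simp: u pk mult.assoc)
  then show ?thesis
    using assms(1) by (simp add: prime_dvd_mult_iff)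
qed

lemma cong_1_iff_least_odd_exponent_dvd:
  assumes "odd n" and "\<not> [q = 1] (mod m)"
  shows "[q ^ n = 1] (mod m) \<longleftrightarrow> (\<exists>f. least_odd_exponent q m f \<and> f dvd n)"
proof
  assume "[q ^ n = 1] (mod m)"
  then have dvd: "ord m q dvd n"
    by (simp only: ord_divides)
  \<comment> \<open>This also excludes 0, the value of \<open>ord m q\<close> when \<open>q\<close>
    and \<open>m\<close> are not coprime.\<close>
  then have "odd (ord m q)"
    using assms(1) by (meson dvd_trans)
  moreover have "ord m q \<noteq> 1"
    using assms(2) ord_divides[of q 1 m] by (metis dvd_refl power_one_right)
  \<comment> \<open>The order divides every such \<open>g\<close>, and an odd \<open>g\<close> is
    positive.\<close>
  moreover have "ord m q \<le> g" if "odd g" "[q ^ g = 1] (mod m)" for g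
    using that unfolding ord_divides by (auto intro: dvd_imp_le odd_pos)
  ultimately have "least_odd_exponent q m (ord m q)"
    using ord[of q m] odd_pos[of "ord m q"] unfolding least_odd_exponent_def
    by (metis nat_neq_iff less_one not_gr_zero)
  with dvd show "\<exists>f. least_odd_exponent q m f \<and> f dvd n"
    by blast
next
  assume "\<exists>f. least_odd_exponent q m f \<and> f dvd n"
  then show "[q ^ n = 1] (mod m)"
    unfolding least_odd_exponent_def ord_divides by (meson dvd_trans)
qed

text \<open>Minimality makes \<open>f\<close> unique. If the order of \<open>q\<close> modulo
  \<open>p ^ k\<close> is even, no \<open>f\<close> exists and both sides are false.\<close>

theorem theorem1p3:
  fixes p q k a :: nat
  assumes "prime p" and "prime q" and "p \<noteq> q"
    and "k > 0" and "p ^ (k - 1) dvd q - 1" and "\<not> p ^ k dvd q - 1"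
    and "a > 0"
  shows "p dvd sigma (q ^ (2 * a)) \<longleftrightarrow>
    (\<exists>f. least_odd_exponent q (p ^ k) f \<and> [2 * a + 1 = 0] (mod f))"
proof -
  \<comment> \<open>Positivity matters: for \<open>x = 0\<close> truncation gives
    \<open>x - 1 = 0\<close>, which every \<open>m\<close> divides.\<close>
  have cong_dvd: "[x = 1] (mod m) \<longleftrightarrow> m dvd x - 1" if "x > 0" for x m :: nat
    using that by (simp add: cong_altdef_nat)
  have "q > 0"
    using assms(2) by (rule prime_gt_0_nat)
  have "p dvd sigma (q ^ (2 * a)) \<longleftrightarrow> p ^ k dvd (q - 1) * sigma (q ^ (2 * a))"
    using assms(1,4-6) by (rule prime_dvd_iff_power_dvd_mult)
  also have "\<dots> \<longleftrightarrow> p ^ k dvd q ^ (2 * a + 1) - 1"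
    using sigma_prime_power_mult[OF assms(2)] by simp
  also have "\<dots> \<longleftrightarrow> [q ^ (2 * a + 1) = 1] (mod p ^ k)"
    using \<open>q > 0\<close> by (intro cong_dvd[symmetric]) simp
  also have "\<dots> \<longleftrightarrow> (\<exists>f. least_odd_exponent q (p ^ k) f \<and> f dvd 2 * a + 1)"
    using cong_dvd[OF \<open>q > 0\<close>] assms(6) by (intro cong_1_iff_least_odd_exponent_dvd) auto
  finally show ?thesis
    by (simp only: cong_0_iff)
qed

end
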